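(* Let $X$ be a compact metric space and let $f:X\to X$ be continuous. If $f$ has positive topological entropy, or if $f$ is weakly mixing with respect to some $f$-invariant Borel probability measure $\mu$ whose support is non-trivial (i.e. not a single point), then $f$ has infinite separation numbers.
   Context: Let $(X,d)$ be a metric space and $f:X\to X$. For $x,y\in X$, $\delta>0$, $n\in\mathbb{N}$ let $S_n(f,\delta,x,y)=\#\{0\le k<n \mid d(f^k(x),f^k(y))\ge\delta\}$. For $\nu\in(0,1]$, points $x,y$ are $(f,\delta,\nu)$-separated if $\limsup_{n\to\infty} S_n(f,\delta,x,y)/n\ge\nu$. A subset $S\subseteq X$ is $(f,\delta,\nu)$-separated if all pairs of distinct points of $S$ are $(f,\delta,\nu)$-separated. The (asymptotic) separation number $\operatorname{Sep}(f,\delta,\nu)$ is the largest cardinality (possibly $\infty$) of an $(f,\delta,\nu)$-separated subset of $X$. The map $f$ has finite separation numbers if $\operatorname{Sep}(f,\delta,\nu)<\infty$ for all $\delta>0$ and $\nu\in(0,1]$; otherwise it has infinite separation numbers. *)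

theory Defs
  imports "HOL-Probability.Probability"
begin

text \<open>
  The compact metric space is a carrier set \<open>X\<close> in a type of class \<open>metric_space\<close>, with the
  restricted metric, and \<open>f\<close> is a self-map of \<open>X\<close> (its values outside \<open>X\<close> play no role).
  A Borel measure on \<open>X\<close> is a measure whose \<open>\<sigma>\<close>-algebra is that of \<open>restrict_space borel X\<close>.
\<close>

definition ecard :: "'a set \<Rightarrow> enat" where
  "ecard S = (if finite S then enat (card S) else \<infinity>)"

subsection \<open>Separation numbers\<close>

definition sep_count :: "('a::metric_space \<Rightarrow> 'a) \<Rightarrow> real \<Rightarrow> 'a \<Rightarrow> 'a \<Rightarrow> nat \<Rightarrow> nat" where
  "sep_count f \<delta> x y n = card {k. k < n \<and> dist ((f ^^ k) x) ((f ^^ k) y) \<ge> \<delta>}"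

definition separated_points :: "('a::metric_space \<Rightarrow> 'a) \<Rightarrow> real \<Rightarrow> real \<Rightarrow> 'a \<Rightarrow> 'a \<Rightarrow> bool" where
  "separated_points f \<delta> \<nu> x y \<longleftrightarrow>
     limsup (\<lambda>n. ereal (real (sep_count f \<delta> x y n) / real n)) \<ge> ereal \<nu>"

definition separated_set :: "('a::metric_space \<Rightarrow> 'a) \<Rightarrow> real \<Rightarrow> real \<Rightarrow> 'a set \<Rightarrow> bool" where
  "separated_set f \<delta> \<nu> S \<longleftrightarrow> (\<forall>x\<in>S. \<forall>y\<in>S. x \<noteq> y \<longrightarrow> separated_points f \<delta> \<nu> x y)"

text \<open>A supremum in \<open>enat\<close> is attained unless it is \<open>\<infinity>\<close>, so a finite value is a maximum.\<close>

definition Sep :: "'a::metric_space set \<Rightarrow> ('a \<Rightarrow> 'a) \<Rightarrow> real \<Rightarrow> real \<Rightarrow> enat" where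
  "Sep X f \<delta> \<nu> = (SUP S \<in> {S. S \<subseteq> X \<and> separated_set f \<delta> \<nu> S}. ecard S)"

definition finite_separation_numbers :: "'a::metric_space set \<Rightarrow> ('a \<Rightarrow> 'a) \<Rightarrow> bool" where
  "finite_separation_numbers X f \<longleftrightarrow> (\<forall>\<delta>>0. \<forall>\<nu>\<in>{0<..1}. Sep X f \<delta> \<nu> < \<infinity>)"

abbreviation infinite_separation_numbers :: "'a::metric_space set \<Rightarrow> ('a \<Rightarrow> 'a) \<Rightarrow> bool" where
  "infinite_separation_numbers X f \<equiv> \<not> finite_separation_numbers X f"

subsection \<open>Topological entropy\<close>

text \<open>Bowen's definition: growth rate of the maximal cardinality of \<open>(n, \<delta>)\<close>-separated sets.\<close>

definition bowen_separated :: "('a::metric_space \<Rightarrow> 'a) \<Rightarrow> real \<Rightarrow> nat \<Rightarrow> 'a set \<Rightarrow> bool" where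
  "bowen_separated f \<delta> n S \<longleftrightarrow>
     (\<forall>x\<in>S. \<forall>y\<in>S. x \<noteq> y \<longrightarrow> (\<exists>k<n. dist ((f ^^ k) x) ((f ^^ k) y) \<ge> \<delta>))"

definition bowen_number :: "'a::metric_space set \<Rightarrow> ('a \<Rightarrow> 'a) \<Rightarrow> real \<Rightarrow> nat \<Rightarrow> enat" where
  "bowen_number X f \<delta> n = (SUP S \<in> {S. S \<subseteq> X \<and> bowen_separated f \<delta> n S}. ecard S)"

definition elog :: "enat \<Rightarrow> ereal" where
  "elog m = (case m of enat k \<Rightarrow> if k = 0 then -\<infinity> else ereal (ln (real k)) | \<infinity> \<Rightarrow> \<infinity>)"

definition bowen_growth :: "'a::metric_space set \<Rightarrow> ('a \<Rightarrow> 'a) \<Rightarrow> real \<Rightarrow> ereal" where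
  "bowen_growth X f \<delta> = limsup (\<lambda>n. elog (bowen_number X f \<delta> n) / ereal (real n))"

text \<open>
  The growth rate is antitone in \<open>\<delta>\<close>, so the supremum is the usual limit as \<open>\<delta>\<close> tends to \<open>0\<close>;
  see \<open>bowen_growth_tendsto_top_entropy\<close> below.
\<close>

definition top_entropy :: "'a::metric_space set \<Rightarrow> ('a \<Rightarrow> 'a) \<Rightarrow> ereal" where
  "top_entropy X f = (SUP \<delta>\<in>{0<..}. bowen_growth X f \<delta>)"

lemma elog_mono: "a \<le> b \<Longrightarrow> elog a \<le> elog b"
  by (cases a; cases b) (auto simp: elog_def)

lemma bowen_growth_antimono:
  assumes "\<delta> \<le> \<epsilon>"
  shows "bowen_growth X f \<epsilon> \<le> bowen_growth X f \<delta>"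
proof -
  have "{S. S \<subseteq> X \<and> bowen_separated f \<epsilon> n S} \<subseteq> {S. S \<subseteq> X \<and> bowen_separated f \<delta> n S}" for n
    using assms unfolding bowen_separated_def by (fastforce intro: order_trans)
  hence "bowen_number X f \<epsilon> n \<le> bowen_number X f \<delta> n" for n
    unfolding bowen_number_def by (intro SUP_subset_mono) auto
  hence le: "elog (bowen_number X f \<epsilon> n) \<le> elog (bowen_number X f \<delta> n)" for n
    by (rule elog_mono)
  show ?thesis
    unfolding bowen_growth_def
  proof (intro Limsup_mono eventually_sequentiallyI[of 1])
    fix n :: nat assume "1 \<le> n"
    thus "elog (bowen_number X f \<epsilon> n) / ereal (real n) \<le> elog (bowen_number X f \<delta> n) / ereal (real n)"
      using le by (intro ereal_divide_right_mono) auto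
  qed
qed

lemma bowen_growth_tendsto_top_entropy:
  "(bowen_growth X f \<longlongrightarrow> top_entropy X f) (at_right 0)"
proof (rule increasing_tendsto)
  show "\<forall>\<^sub>F \<delta> in at_right 0. bowen_growth X f \<delta> \<le> top_entropy X f"
    unfolding top_entropy_def
    by (rule eventually_at_right_less[THEN eventually_mono]) (auto intro: SUP_upper)
next
  fix h assume "h < top_entropy X f"
  then obtain \<epsilon> where \<epsilon>: "\<epsilon> > 0" "h < bowen_growth X f \<epsilon>"
    by (auto simp: top_entropy_def less_SUP_iff)
  show "\<forall>\<^sub>F \<delta> in at_right 0. h < bowen_growth X f \<delta>"
    unfolding eventually_at_right_field
    using \<epsilon> bowen_growth_antimono by (meson less_imp_le less_le_trans)
qed

subsection \<open>Invariant measures and weak mixing\<close>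

definition invariant_measure :: "'a measure \<Rightarrow> ('a \<Rightarrow> 'a) \<Rightarrow> bool" where
  "invariant_measure \<mu> f \<longleftrightarrow> f \<in> measurable \<mu> \<mu> \<and> distr \<mu> \<mu> f = \<mu>"

definition weakly_mixing :: "'a measure \<Rightarrow> ('a \<Rightarrow> 'a) \<Rightarrow> bool" where
  "weakly_mixing \<mu> f \<longleftrightarrow> (\<forall>A\<in>sets \<mu>. \<forall>B\<in>sets \<mu>.
     (\<lambda>n. (\<Sum>k<n. \<bar>measure \<mu> (((f ^^ k) -` A \<inter> space \<mu>) \<inter> B) - measure \<mu> A * measure \<mu> B\<bar>) / real n)
       \<longlonglongrightarrow> 0)"

definition measure_support :: "'a::topological_space measure \<Rightarrow> 'a set" where
  "measure_support \<mu> =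
     {x \<in> space \<mu>. \<forall>U. open U \<longrightarrow> x \<in> U \<longrightarrow> emeasure \<mu> (U \<inter> space \<mu>) > 0}"

end

theory Submission
  imports Defs
begin

text \<open>
  If all separation numbers are finite, then for all \<open>\<delta>\<close>, \<open>\<nu>\<close> there is a finite set \<open>F\<close> (a maximal
  separated set) such that every \<open>y\<close> stays \<open>\<delta>\<close>-close to the orbit of some \<open>x \<in> F\<close>, except for a set
  of times of upper density less than \<open>\<nu>\<close>.

  Entropy: for small \<open>\<nu>\<close> the orbit segments of length \<open>n\<close> which do so are covered by few sets of
  small Bowen diameter, at most \<open>exp (h n / 2)\<close> for each \<open>x\<close>. The length \<open>n\<close> that
  works depends on the point, but, as in the proof that Bowen's dimension-like entropy
  of a compact set is the topological one, compactness yields a finite cover by sets \<open>W\<^sub>j\<close> of small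
  \<open>n\<^sub>j\<close>-Bowen diameter with \<open>\<Sum>j. exp (-h n\<^sub>j) \<le> 1\<close>. The maximal cardinalities \<open>b\<close> of
  Bowen separated sets satisfy \<open>b n \<le> \<Sum>j. b (n - n\<^sub>j)\<close>, so \<open>b\<close> has growth rate at most \<open>h\<close>.

  Weak mixing: let \<open>A\<close>, \<open>B\<close> be small balls around two points of the support. Some \<open>x \<in> F\<close> is
  shadowed, uniformly from some time on, by a set \<open>Y\<close> of positive measure. At each time the orbit
  of \<open>x\<close> is far from \<open>A\<close> or from \<open>B\<close>, while \<open>Y\<close> equidistributes along most times,
  so that points of \<open>Y\<close> are on average separated from \<open>x\<close> with frequency at least
  \<open>min (\<mu> A) (\<mu> B)\<close>.
\<close>

section \<open>Finite shadowing sets\<close>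

lemma sep_count_commute: "sep_count f \<delta> x y n = sep_count f \<delta> y x n"
  by (simp add: sep_count_def dist_commute)

lemma separated_points_commute: "separated_points f \<delta> \<nu> x y \<longleftrightarrow> separated_points f \<delta> \<nu> y x"
  by (simp add: separated_points_def sep_count_commute[of f \<delta> x])

lemma not_separated_points_self:
  assumes "\<delta> > 0" "\<nu> > 0"
  shows "\<not> separated_points f \<delta> \<nu> x x"
proof -
  have "sep_count f \<delta> x x n = 0" for n
    using assms by (simp add: sep_count_def)
  thus ?thesis
    using assms by (simp add: separated_points_def Limsup_const zero_ereal_def)
qed

lemma not_separated_pointsD:
  assumes "\<not> separated_points f \<delta> \<nu> x y"
  obtains N where "\<And>n. n \<ge> N \<Longrightarrow> real (sep_count f \<delta> x y n) < \<nu> * real n"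
proof -
  have "limsup (\<lambda>n. ereal (real (sep_count f \<delta> x y n) / real n)) < ereal \<nu>"
    using assms by (simp add: separated_points_def not_le)
  from Limsup_lessD[OF this] obtain N where
    N: "\<And>n. n \<ge> N \<Longrightarrow> real (sep_count f \<delta> x y n) / real n < \<nu>"
    by (auto simp: eventually_sequentially)
  show thesis
  \<comment> \<open>At \<open>n = 0\<close> the strict inequality would read \<open>0 < 0\<close>,
    so the range starts at 1.\<close>
  proof (rule that[of "max 1 N"])
    fix n assume "max 1 N \<le> n"
    thus "real (sep_count f \<delta> x y n) < \<nu> * real n"
      using N[of n] by (simp add: divide_simps mult.commute)
  qed
qed

text \<open>A separated set of maximal cardinality exists because the finite value of
  \<open>Sep\<close> bounds all of them; a point separated from each of its elements could be added
  to it.\<close>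

lemma finite_shadowing_set:
  assumes fin: "Sep X f \<delta> \<nu> < \<infinity>" and pos: "\<delta> > 0" "\<nu> > 0"
  obtains F where "finite F" "F \<subseteq> X"
    "\<And>y. y \<in> X \<Longrightarrow> \<exists>x\<in>F. \<exists>N. \<forall>n\<ge>N. real (sep_count f \<delta> y x n) < \<nu> * real n"
proof -
  let ?P = "\<lambda>S. S \<subseteq> X \<and> separated_set f \<delta> \<nu> S"
  obtain m where m: "Sep X f \<delta> \<nu> = enat m"
    using fin by auto
  have bd: "finite S \<and> card S \<le> m" if "?P S" for S
  proof -
    have "ecard S \<le> Sep X f \<delta> \<nu>"
      unfolding Sep_def using that by (intro SUP_upper) auto
    thus ?thesis
      by (auto simp: m ecard_def split: if_splits)
  qed
  have "?P {}"
    by (simp add: separated_set_def)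
  moreover have "\<forall>S. ?P S \<longrightarrow> card S < Suc m"
    using bd by (simp add: less_Suc_eq_le)
  ultimately obtain F where F: "?P F" and max: "\<And>S. ?P S \<Longrightarrow> card S \<le> card F"
    using ex_has_greatest_nat[of ?P "{}" card "Suc m"] by blast
  have "\<exists>x\<in>F. \<not> separated_points f \<delta> \<nu> y x" if "y \<in> X" for y
  proof (cases "y \<in> F")
    case True
    thus ?thesis using not_separated_points_self[OF pos] by blast
  next
    case False
    show ?thesis
    proof (rule ccontr)
      assume "\<not> ?thesis"
      hence "?P (insert y F)"
        using F that separated_points_commute[of f \<delta> \<nu>]
        unfolding separated_set_def by (metis insert_iff insert_subset)
      from max[OF this] show False
        using False bd[OF F] by simp
    qed
  qed
  hence "\<exists>x\<in>F. \<exists>N. \<forall>n\<ge>N. real (sep_count f \<delta> y x n) < \<nu> * real n" if "y \<in> X" for y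
    using that not_separated_pointsD by metis
  thus thesis
    using that[of F] F bd[OF F] by blast
qed

section \<open>Topological entropy\<close>

lemma funpow_image_subset: "f ` X \<subseteq> X \<Longrightarrow> (f ^^ k) ` X \<subseteq> X"
  by (induction k) auto

lemma continuous_on_funpow:
  assumes "continuous_on X f" "f ` X \<subseteq> X"
  shows "continuous_on X (f ^^ k)"
proof (induction k)
  case (Suc k)
  thus ?case
    using assms funpow_image_subset[of f X k]
    by (auto intro!: continuous_on_compose2[of X f X "f ^^ k"])
qed (auto simp: id_def)

section \<open>Growth of Bowen separated sets under a weighted cover\<close>

lemma bowen_separated_0D:
  assumes "bowen_separated f \<epsilon> 0 S"
  shows "finite S \<and> card S \<le> 1"
proof (cases "S = {}")
  case False
  then obtain x where "S = {x}"
    using assms by (auto simp: bowen_separated_def)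
  thus ?thesis by simp
qed simp

text \<open>No pair in \<open>S\<close> is separated before time \<open>l\<close>, so each pair is
  separated at some \<open>k \<ge> l\<close>, which is time \<open>k - l\<close> for the images. If
  \<open>l \<ge> n\<close>, the truncated difference is 0 and the set has at most one point.\<close>

lemma bowen_separated_shift:
  assumes "bowen_separated f \<epsilon> n S" "\<epsilon> > 0"
    and close: "\<And>x y k. x \<in> S \<Longrightarrow> y \<in> S \<Longrightarrow> k < l \<Longrightarrow> dist ((f ^^ k) x) ((f ^^ k) y) < \<epsilon>"
  shows "inj_on (f ^^ l) S" "bowen_separated f \<epsilon> (n - l) ((f ^^ l) ` S)"
proof -
  have *: "\<exists>k<n - l. dist ((f ^^ k) ((f ^^ l) x)) ((f ^^ k) ((f ^^ l) y)) \<ge> \<epsilon>"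
    if "x \<in> S" "y \<in> S" "x \<noteq> y" for x y
  proof -
    obtain k where k: "k < n" "dist ((f ^^ k) x) ((f ^^ k) y) \<ge> \<epsilon>"
      using assms(1) \<open>x \<in> S\<close> \<open>y \<in> S\<close> \<open>x \<noteq> y\<close> by (auto simp: bowen_separated_def)
    have "l \<le> k"
      using close[of x y k] \<open>x \<in> S\<close> \<open>y \<in> S\<close> k by (meson linorder_not_less)
    hence "(f ^^ k) z = (f ^^ (k - l)) ((f ^^ l) z)" for z
      by (metis comp_apply funpow_add le_add_diff_inverse2)
    thus ?thesis
      using k \<open>l \<le> k\<close> by (intro exI[of _ "k - l"]) auto
  qed
  show "inj_on (f ^^ l) S"
    by (rule inj_onI) (use * \<open>\<epsilon> > 0\<close> in force)
  show "bowen_separated f \<epsilon> (n - l) ((f ^^ l) ` S)"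
    unfolding bowen_separated_def using * by blast
qed

text \<open>Strong induction on \<open>n\<close>: the part of \<open>S\<close> in
  \<open>W j\<close>, moved by \<open>len j\<close> steps, is separated for
  \<open>n - len j\<close>, and \<open>wt\<close> makes the bounds for the parts add up. If
  \<open>len j \<ge> n\<close>, the part has at most one point; the slack \<open>R\<close> keeps its
  bound at least 1.\<close>

lemma bowen_separated_card_le:
  assumes fX: "f ` X \<subseteq> X" and eps: "\<epsilon> > 0" and lam: "h \<ge> 0"
    and J: "finite J" and cov: "X \<subseteq> (\<Union>j\<in>J. W j)"
    and len: "\<And>j. j \<in> J \<Longrightarrow> 0 < len j" "\<And>j. j \<in> J \<Longrightarrow> len j \<le> R"
    and diam: "\<And>j x y k. j \<in> J \<Longrightarrow> x \<in> W j \<Longrightarrow> y \<in> W j \<Longrightarrow> k < len j \<Longrightarrow>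
                 dist ((f ^^ k) x) ((f ^^ k) y) < \<epsilon>"
    and wt: "(\<Sum>j\<in>J. exp (- (h * real (len j)))) \<le> 1"
    and S: "S \<subseteq> X" "bowen_separated f \<epsilon> n S"
  shows "finite S \<and> real (card S) \<le> exp (h * (real n + real R))"
  using S
proof (induction n arbitrary: S rule: less_induct)
  case (less n)
  show ?case
  proof (cases "n = 0")
    case True
    have "1 \<le> exp (h * (real n + real R))"
      using lam by simp
    moreover have "finite S \<and> card S \<le> 1"
      using bowen_separated_0D less.prems(2) True by blast
    ultimately show ?thesis by linarith
  next
    case False
    have *: "finite (S \<inter> W j) \<and>
        real (card (S \<inter> W j)) \<le> exp (h * (real n + real R)) * exp (- (h * real (len j)))"
      if j: "j \<in> J" for j
    proof -
      have sep: "bowen_separated f \<epsilon> n (S \<inter> W j)"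
        using less.prems(2) by (auto simp: bowen_separated_def)
      note sh = bowen_separated_shift[OF sep eps, of "len j"]
      let ?T = "(f ^^ len j) ` (S \<inter> W j)"
      have inj: "inj_on (f ^^ len j) (S \<inter> W j)" and T: "bowen_separated f \<epsilon> (n - len j) ?T"
        using sh diam[OF j] by auto
      have TX: "?T \<subseteq> X"
        using less.prems(1) funpow_image_subset[OF fX, of "len j"] by blast
      have eq: "exp (h * (real n + real R)) * exp (- (h * real (len j)))
                = exp (h * (real n + real R - real (len j)))"
        by (simp add: exp_add[symmetric] algebra_simps)
      have "finite ?T \<and> real (card ?T) \<le> exp (h * (real n + real R - real (len j)))"
      proof (cases "len j < n")
        case True
        have "finite ?T \<and> real (card ?T) \<le> exp (h * (real (n - len j) + real R))"
          using less.IH[OF _ TX T] len(1)[OF j] False by simp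
        thus ?thesis
          using True by (simp add: of_nat_diff algebra_simps)
      next
        case False
        have "1 \<le> exp (h * (real n + real R - real (len j)))"
          using lam len(2)[OF j] by simp
        moreover have "finite ?T \<and> card ?T \<le> 1"
          using bowen_separated_0D T False by force
        ultimately show ?thesis by linarith
      qed
      thus ?thesis
        unfolding eq using inj by (simp add: card_image finite_image_iff)
    qed
    have eqS: "S = (\<Union>j\<in>J. S \<inter> W j)"
      using less.prems(1) cov by blast
    have "card S \<le> (\<Sum>j\<in>J. card (S \<inter> W j))"
      by (subst eqS) (rule card_UN_le[OF J])
    hence "real (card S) \<le> (\<Sum>j\<in>J. real (card (S \<inter> W j)))"
      by (metis of_nat_le_iff of_nat_sum)
    also have "\<dots> \<le> (\<Sum>j\<in>J. exp (h * (real n + real R)) * exp (- (h * real (len j))))"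
      using * by (intro sum_mono) auto
    also have "\<dots> = exp (h * (real n + real R)) * (\<Sum>j\<in>J. exp (- (h * real (len j))))"
      by (simp add: sum_distrib_left)
    also have "\<dots> \<le> exp (h * (real n + real R))"
      using wt by (simp add: mult_left_le)
    finally have "real (card S) \<le> exp (h * (real n + real R))" .
    moreover have "finite S"
      by (subst eqS) (use * J in blast)
    ultimately show ?thesis by blast
  qed
qed

text \<open>The additive constant \<open>h * R\<close> vanishes after division by
  \<open>n\<close>.\<close>

lemma bowen_growth_le:
  assumes "\<And>n S. S \<subseteq> X \<Longrightarrow> bowen_separated f \<epsilon> n S \<Longrightarrow>
             finite S \<and> real (card S) \<le> exp (h * (real n + real R))"
  shows "bowen_growth X f \<epsilon> \<le> ereal h"
proof -
  have elog_le: "elog (bowen_number X f \<epsilon> n) \<le> ereal (h * (real n + real R))" for n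
  proof -
    define B where "B = nat \<lfloor>exp (h * (real n + real R))\<rfloor>"
    have B: "real B \<le> exp (h * (real n + real R))"
      by (simp add: B_def)
    have "bowen_number X f \<epsilon> n \<le> enat B"
      unfolding bowen_number_def
    proof (intro SUP_least)
      fix S assume "S \<in> {S. S \<subseteq> X \<and> bowen_separated f \<epsilon> n S}"
      hence "finite S \<and> real (card S) \<le> exp (h * (real n + real R))"
        using assms by auto
      thus "ecard S \<le> enat B"
        by (simp add: ecard_def B_def le_nat_floor)
    qed
    hence "elog (bowen_number X f \<epsilon> n) \<le> elog (enat B)"
      by (rule elog_mono)
    also have "\<dots> \<le> ereal (h * (real n + real R))"
      using B by (auto simp: elog_def ln_le_cancel_iff[symmetric] simp del: ln_le_cancel_iff
          intro: ln_le_cancel_iff[THEN iffD2, of _ "exp _", simplified])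
    finally show ?thesis .
  qed
  have "bowen_growth X f \<epsilon> \<le> limsup (\<lambda>n. ereal (h * (real n + real R) / real n))"
    unfolding bowen_growth_def
  proof (intro Limsup_mono eventually_sequentiallyI[of 1])
    fix n :: nat assume n: "1 \<le> n"
    have "elog (bowen_number X f \<epsilon> n) / ereal (real n) \<le> ereal (h * (real n + real R)) / ereal (real n)"
      using n elog_le by (intro ereal_divide_right_mono) auto
    thus "elog (bowen_number X f \<epsilon> n) / ereal (real n) \<le> ereal (h * (real n + real R) / real n)"
      using n by simp
  qed
  also have "\<dots> = ereal h"
  proof (intro lim_imp_Limsup tendsto_ereal)
    have "(\<lambda>n. h + h * real R * (1 / real n)) \<longlonglongrightarrow> h + h * real R * 0"
      by (intro tendsto_intros lim_1_over_n)
    moreover have "\<forall>\<^sub>F n in sequentially. h + h * real R * (1 / real n) = h * (real n + real R) / real n"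
      by (intro eventually_sequentiallyI[of 1]) (simp add: field_simps)
    ultimately show "(\<lambda>n. h * (real n + real R) / real n) \<longlonglongrightarrow> h"
      by (simp add: tendsto_cong)
  qed simp
  finally show ?thesis .
qed

section \<open>Sparse words and their cells\<close>

text \<open>
  A word assigns to each time either \<open>None\<close> (shadow a given orbit) or \<open>Some c\<close> (be close to \<open>c\<close>).
\<close>

definition sparse_words :: "'a set \<Rightarrow> real \<Rightarrow> nat \<Rightarrow> (nat \<Rightarrow> 'a option) set" where
  "sparse_words C \<nu> n =
     {w \<in> PiE {..<n} (\<lambda>_. insert None (Some ` C)). real (card {k\<in>{..<n}. w k \<noteq> None}) \<le> \<nu> * real n}"

lemma finite_sparse_words: "finite C \<Longrightarrow> finite (sparse_words C \<nu> n)"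
  by (rule finite_subset[of _ "PiE {..<n} (\<lambda>_. insert None (Some ` C))"])
    (auto simp: sparse_words_def intro: finite_PiE)

text \<open>
  Weighting each letter other than \<open>None\<close> by \<open>exp (-\<tau>)\<close>, all words together weigh
  \<open>(1 + card C * exp (-\<tau>)) ^ n\<close>, and a sparse word weighs at least \<open>exp (- \<tau> * \<nu> * n)\<close>.
\<close>
lemma card_sparse_words_le:
  assumes "finite C" and tau: "\<tau> \<ge> 0" "real (card C) * exp (- \<tau>) \<le> c" "\<tau> * \<nu> \<le> c"
  shows "real (card (sparse_words C \<nu> n)) \<le> exp (2 * c * real n)"
proof -
  define g :: "'a option \<Rightarrow> real" where "g = (\<lambda>a. if a = None then 1 else exp (- \<tau>))"
  let ?W = "PiE {..<n} (\<lambda>_. insert None (Some ` C))"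
  have g: "g a > 0" for a by (simp add: g_def)
  have "real (card (sparse_words C \<nu> n)) * exp (- (c * real n))
        = (\<Sum>w\<in>sparse_words C \<nu> n. exp (- (c * real n)))"
    by simp
  also have "\<dots> \<le> (\<Sum>w\<in>sparse_words C \<nu> n. \<Prod>k<n. g (w k))"
  proof (intro sum_mono)
    fix w assume w: "w \<in> sparse_words C \<nu> n"
    let ?K = "{k\<in>{..<n}. w k \<noteq> None}"
    have "(\<Prod>k<n. g (w k)) = (\<Prod>k\<in>?K. exp (- \<tau>))"
      by (intro prod.mono_neutral_cong_right) (auto simp: g_def)
    also have "\<dots> = exp (- (\<tau> * real (card ?K)))"
      by (simp add: exp_of_nat_mult[symmetric] mult.commute)
    finally have eq: "(\<Prod>k<n. g (w k)) = exp (- (\<tau> * real (card ?K)))" .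
    have "\<tau> * real (card ?K) \<le> \<tau> * (\<nu> * real n)"
      using w tau(1) by (intro mult_left_mono) (auto simp: sparse_words_def)
    also have "\<dots> = (\<tau> * \<nu>) * real n" by simp
    also have "\<dots> \<le> c * real n"
      using tau(3) by (intro mult_right_mono) auto
    finally show "exp (- (c * real n)) \<le> (\<Prod>k<n. g (w k))"
      unfolding eq by simp
  qed
  also have "\<dots> \<le> (\<Sum>w\<in>?W. \<Prod>k<n. g (w k))"
    using \<open>finite C\<close> g
    by (intro sum_mono2 finite_PiE prod_nonneg) (auto simp: sparse_words_def less_imp_le)
  \<comment> \<open>The weight of a word is a product over its letters, so the sum over all words
    factors; each factor is at most \<open>1 + c \<le> exp c\<close>.\<close>
  also have "\<dots> = (\<Prod>k<n. \<Sum>a\<in>insert None (Some ` C). g a)"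
    using \<open>finite C\<close> by (subst prod_sum_PiE) auto
  also have "(\<Sum>a\<in>insert None (Some ` C). g a) = 1 + real (card C) * exp (- \<tau>)"
    using \<open>finite C\<close> by (subst sum.insert) (auto simp: g_def sum.reindex)
  also have "(\<Prod>k<n. 1 + real (card C) * exp (- \<tau>)) \<le> (\<Prod>k<n. exp c)"
    using order_trans[OF add_left_mono[OF tau(2)] exp_ge_add_one_self]
    by (intro prod_mono) (auto simp: add_nonneg_nonneg)
  also have "\<dots> = exp (c * real n)"
    by (simp add: exp_of_nat_mult[symmetric] mult.commute)
  finally have "real (card (sparse_words C \<nu> n)) \<le> exp (c * real n) / exp (- (c * real n))"
    by (simp add: field_simps)
  also have "\<dots> = exp (2 * c * real n)"
    by (simp add: exp_diff[symmetric])
  finally show ?thesis .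
qed

text \<open>A Bowen ball of order \<open>n\<close> with a centre prescribed separately at each time;
  the word with only \<open>None\<close> gives the usual Bowen ball about \<open>x\<close> in
  \<open>X\<close>.\<close>

definition word_cell ::
  "'a::metric_space set \<Rightarrow> ('a \<Rightarrow> 'a) \<Rightarrow> real \<Rightarrow> 'a \<Rightarrow> nat \<Rightarrow> (nat \<Rightarrow> 'a option) \<Rightarrow> 'a set" where
  "word_cell X f \<delta> x n w =
     {y \<in> X. \<forall>k<n. (f ^^ k) y \<in> ball (case w k of None \<Rightarrow> (f ^^ k) x | Some c \<Rightarrow> c) \<delta>}"

lemma openin_word_cell:
  assumes "continuous_on X f" "f ` X \<subseteq> X"
  shows "openin (top_of_set X) (word_cell X f \<delta> x n w)"
proof -
  let ?U = "\<lambda>k. X \<inter> (f ^^ k) -` ball (case w k of None \<Rightarrow> (f ^^ k) x | Some c \<Rightarrow> c) \<delta>"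
  \<comment> \<open>Inserting \<open>X\<close> keeps the family nonempty when
    \<open>n = 0\<close>.\<close>
  have "openin (top_of_set X) (\<Inter> (insert X (?U ` {..<n})))"
    using continuous_openin_preimage_gen[OF continuous_on_funpow[OF assms] open_ball]
    by (intro openin_Inter) auto
  also have "\<Inter> (insert X (?U ` {..<n})) = word_cell X f \<delta> x n w"
    by (auto simp: word_cell_def simp del: INT_simps)
  finally show ?thesis .
qed

lemma dist_word_cell:
  assumes "y \<in> word_cell X f \<delta> x n w" "z \<in> word_cell X f \<delta> x n w" "k < n"
  shows "dist ((f ^^ k) y) ((f ^^ k) z) < 2 * \<delta>"
proof -
  let ?c = "case w k of None \<Rightarrow> (f ^^ k) x | Some c \<Rightarrow> c"
  have "dist ?c ((f ^^ k) y) < \<delta>" "dist ?c ((f ^^ k) z) < \<delta>"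
    using assms by (auto simp: word_cell_def)
  thus ?thesis
    by metric
qed

text \<open>The word is read off the orbit of \<open>y\<close>: \<open>None\<close> at times when it
  is \<open>\<delta>\<close>-close to that of \<open>x\<close>, otherwise a centre in
  \<open>C\<close> near the orbit. The letters other than \<open>None\<close> number exactly
  \<open>sep_count f \<delta> y x n\<close>.\<close>

lemma ex_sparse_word:
  assumes fX: "f ` X \<subseteq> X" and C: "X \<subseteq> (\<Union>c\<in>C. ball c \<delta>)" and y: "y \<in> X"
    and sep: "real (sep_count f \<delta> y x n) \<le> \<nu> * real n"
  shows "\<exists>w\<in>sparse_words C \<nu> n. y \<in> word_cell X f \<delta> x n w"
proof -
  have fy: "(f ^^ k) y \<in> X" for k
    using funpow_image_subset[OF fX] y by blast
  hence "\<forall>k. \<exists>c\<in>C. (f ^^ k) y \<in> ball c \<delta>"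
    using C by blast
  then obtain c where c: "\<And>k. c k \<in> C" "\<And>k. (f ^^ k) y \<in> ball (c k) \<delta>"
    by metis
  define w where "w = (\<lambda>k\<in>{..<n}. if dist ((f ^^ k) y) ((f ^^ k) x) \<ge> \<delta> then Some (c k) else None)"
  have "{k\<in>{..<n}. w k \<noteq> None} = {k. k < n \<and> dist ((f ^^ k) y) ((f ^^ k) x) \<ge> \<delta>}"
    by (auto simp: w_def)
  hence "w \<in> sparse_words C \<nu> n"
    using sep c(1) by (auto simp: sparse_words_def sep_count_def w_def)
  moreover have "y \<in> word_cell X f \<delta> x n w"
    using y fy c(2) by (auto simp: word_cell_def w_def dist_commute)
  ultimately show ?thesis by blast
qed

text \<open>The cells of all sparse words of length at least \<open>max 1 L\<close> form an open
  cover. Whatever finite subcover compactness selects, its weight is at most a tail of a geometric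
  series, so \<open>bowen_separated_card_le\<close> applies.\<close>

lemma bowen_growth_le_of_finite_Sep:
  assumes X: "compact X" and cont: "continuous_on X f" and fX: "f ` X \<subseteq> X"
    and fin: "finite_separation_numbers X f" and eps: "\<epsilon> > 0" and lam: "h > 0"
  shows "bowen_growth X f \<epsilon> \<le> ereal h"
proof -
  \<comment> \<open>Points of one cell stay less than \<open>2 * \<delta> = \<epsilon>\<close>
    apart. With this \<open>c\<close> there are at most \<open>exp (h * n / 2)\<close> sparse words
    of length \<open>n\<close>, so weights \<open>exp (- (h * n))\<close> still decay
    geometrically.\<close>
  define \<delta> where "\<delta> = \<epsilon> / 2"
  define c where "c = h / 4"
  have pos: "\<delta> > 0" "c > 0"
    using eps lam by (auto simp: \<delta>_def c_def)
  obtain C where C: "finite C" "X \<subseteq> (\<Union>x\<in>C. ball x \<delta>)"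
    using X pos unfolding compact_eq_totally_bounded by blast
  \<comment> \<open>First \<open>\<tau>\<close> is made large, then \<open>\<nu>\<close> small, to
    meet the two conditions of \<open>card_sparse_words_le\<close>. The 1 added to
    \<open>card C\<close> keeps the argument of \<open>ln\<close> positive.\<close>
  define \<tau> where "\<tau> = max 1 (ln (real (card C + 1) / c))"
  have \<tau>: "\<tau> \<ge> 1" by (simp add: \<tau>_def)
  have "real (card C + 1) / c = exp (ln (real (card C + 1) / c))"
    using pos by simp
  also have "\<dots> \<le> exp \<tau>"
    by (simp only: exp_le_cancel_iff) (simp add: \<tau>_def)
  finally have "real (card C + 1) \<le> c * exp \<tau>"
    using pos by (simp add: field_simps)
  hence \<tau>C: "real (card C) * exp (- \<tau>) \<le> c"
    by (simp add: exp_minus field_simps)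
  define \<nu> where "\<nu> = min 1 (c / \<tau>)"
  have \<nu>: "0 < \<nu>" "\<nu> \<le> 1" "\<tau> * \<nu> \<le> c"
    using pos \<tau> by (auto simp: \<nu>_def min_def field_simps)
  have "Sep X f \<delta> \<nu> < \<infinity>"
    using fin pos \<nu> by (auto simp: finite_separation_numbers_def)
  then obtain F where F: "finite F" "F \<subseteq> X"
    and shadow: "\<And>y. y \<in> X \<Longrightarrow> \<exists>x\<in>F. \<exists>N. \<forall>n\<ge>N. real (sep_count f \<delta> y x n) < \<nu> * real n"
    using finite_shadowing_set pos \<nu> by metis
  define q where "q = exp (- (h / 2))"
  have "summable (\<lambda>n. real (card F) * q ^ n)"
    using lam by (intro summable_mult summable_geometric) (simp add: q_def)
  \<comment> \<open>The tail from \<open>L\<close> on is below 1; using \<open>max 1 L\<close> below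
    also makes every length positive.\<close>
  then obtain L where L: "\<And>m n. m \<ge> L \<Longrightarrow> norm (\<Sum>n\<in>{m..<n}. real (card F) * q ^ n) < 1"
    unfolding summable_Cauchy using zero_less_one by blast
  define I where "I = (SIGMA x:F. SIGMA n:{max 1 L..}. sparse_words C \<nu> n)"
  define W where "W = (\<lambda>(x, n, w). word_cell X f \<delta> x n w)"
  define len where "len = (\<lambda>(x :: 'a, n, w :: nat \<Rightarrow> 'a option). n :: nat)"
  have "X \<subseteq> \<Union> (W ` I)"
  proof
    fix y assume y: "y \<in> X"
    then obtain x N where x: "x \<in> F" and "\<forall>n\<ge>N. real (sep_count f \<delta> y x n) < \<nu> * real n"
      using shadow by blast
    \<comment> \<open>The time from which shadowing holds depends on \<open>y\<close>, so each
      \<open>y\<close> gets its own length.\<close>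
    hence "real (sep_count f \<delta> y x (max N (max 1 L))) \<le> \<nu> * real (max N (max 1 L))"
      by (meson less_imp_le max.cobounded1)
    from ex_sparse_word[OF fX C(2) y this] obtain w
      where "w \<in> sparse_words C \<nu> (max N (max 1 L))" "y \<in> word_cell X f \<delta> x (max N (max 1 L)) w"
      by blast
    thus "y \<in> \<Union> (W ` I)"
      using x unfolding I_def W_def
      by (intro UN_I[of "(x, max N (max 1 L), w)"]) auto
  qed
  moreover have "\<forall>V\<in>W ` I. openin (top_of_set X) V"
    using openin_word_cell[OF cont fX] by (auto simp: W_def)
  ultimately obtain D where "D \<subseteq> W ` I" "finite D" "X \<subseteq> \<Union> D"
    using X unfolding compact_eq_openin_cover by meson
  then obtain J where J: "J \<subseteq> I" "finite J" "X \<subseteq> (\<Union>j\<in>J. W j)"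
    by (metis finite_subset_image)
  define R where "R = Max (insert 0 (len ` J))"
  have lenR: "len j \<le> R" if "j \<in> J" for j
    using that J(2) by (auto simp: R_def)
  \<comment> \<open>Truncating \<open>I\<close> at \<open>R\<close> gives a finite index set that
    contains \<open>J\<close> and over which the sum can be iterated.\<close>
  let ?K = "SIGMA x:F. SIGMA n:{max 1 L..<Suc R}. sparse_words C \<nu> n"
  have "(\<Sum>j\<in>J. exp (- (h * real (len j)))) \<le> (\<Sum>j\<in>?K. exp (- (h * real (len j))))"
  proof (rule sum_mono2)
    show "finite ?K"
      using F C by (intro finite_SigmaI finite_sparse_words) auto
    show "J \<subseteq> ?K"
      using J(1) lenR by (fastforce simp: I_def len_def)
  qed simp
  also have "\<dots> = (\<Sum>x\<in>F. \<Sum>n\<in>{max 1 L..<Suc R}. \<Sum>w\<in>sparse_words C \<nu> n. exp (- (h * real n)))"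
    using F C by (simp add: sum.Sigma finite_sparse_words len_def split_beta del: sum_constant sum.op_ivl_Suc)
  also have "\<dots> = (\<Sum>n\<in>{max 1 L..<Suc R}.
                     real (card F) * (real (card (sparse_words C \<nu> n)) * exp (- (h * real n))))"
    by (simp add: sum_distrib_left del: sum.op_ivl_Suc)
  also have "\<dots> \<le> (\<Sum>n\<in>{max 1 L..<Suc R}. real (card F) * q ^ n)"
  proof (intro sum_mono mult_left_mono)
    fix n
    have "real (card (sparse_words C \<nu> n)) * exp (- (h * real n))
          \<le> exp (2 * c * real n) * exp (- (h * real n))"
      using card_sparse_words_le[OF C(1) _ \<tau>C \<nu>(3)] \<tau> by (intro mult_right_mono) auto
    also have "\<dots> = q ^ n"
      by (simp add: q_def c_def exp_add[symmetric] exp_of_nat_mult[symmetric])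
    finally show "real (card (sparse_words C \<nu> n)) * exp (- (h * real n)) \<le> q ^ n" .
  qed simp
  also have "\<dots> \<le> 1"
    using L[of "max 1 L" "Suc R"] by simp
  finally have wt: "(\<Sum>j\<in>J. exp (- (h * real (len j)))) \<le> 1" .
  have len0: "0 < len j" if "j \<in> J" for j
    using that J(1) by (auto simp: I_def len_def)
  have diam: "dist ((f ^^ k) x) ((f ^^ k) y) < \<epsilon>"
    if "j \<in> J" "x \<in> W j" "y \<in> W j" "k < len j" for j x y k
  proof -
    obtain a n w where "j = (a, n, w)" by (cases j)
    thus ?thesis
      using that dist_word_cell[of x X f \<delta> a n w y k] by (simp add: W_def len_def \<delta>_def)
  qed
  show ?thesis
  proof (rule bowen_growth_le)
    fix n S assume S: "S \<subseteq> X" "bowen_separated f \<epsilon> n S"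
    show "finite S \<and> real (card S) \<le> exp (h * (real n + real R))"
      by (rule bowen_separated_card_le[OF fX eps less_imp_le[OF lam] J(2,3), where len = len])
        (fact len0 lenR diam wt S)+
  qed
qed

lemma top_entropy_le_0_of_finite_Sep:
  assumes "compact X" "continuous_on X f" "f ` X \<subseteq> X" "finite_separation_numbers X f"
  shows "top_entropy X f \<le> 0"
  unfolding top_entropy_def
proof (intro SUP_least)
  fix \<epsilon> :: real assume "\<epsilon> \<in> {0<..}"
  hence "bowen_growth X f \<epsilon> \<le> ereal h" if "h > 0" for h
    using bowen_growth_le_of_finite_Sep[OF assms] that by simp
  thus "bowen_growth X f \<epsilon> \<le> 0"
    by - (rule ereal_le_epsilon2, auto)
qed

section \<open>Weak mixing\<close>

lemma open_Int_in_sets: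
  assumes "sets \<mu> = sets (restrict_space borel X)" "open U"
  shows "U \<inter> X \<in> sets \<mu>"
proof -
  have "X \<inter> U \<in> (\<inter>) X ` sets borel"
    by (intro imageI borel_open assms)
  thus ?thesis
    unfolding assms(1) sets_restrict_space by (simp only: Int_commute)
qed

text \<open>If the support were empty, finitely many open sets with null trace would cover
  \<open>X\<close>. Hence a support that is not a singleton has two distinct points.\<close>

lemma measure_support_nonempty:
  assumes "compact X" and sets: "sets \<mu> = sets (restrict_space borel X)" and "emeasure \<mu> X \<noteq> 0"
  shows "measure_support \<mu> \<noteq> {}"
proof
  assume empty: "measure_support \<mu> = {}"
  have sp: "space \<mu> = X"
    using sets_eq_imp_space_eq[OF sets] by (simp add: space_restrict_space)
  have "\<forall>x\<in>X. \<exists>U. open U \<and> x \<in> U \<and> emeasure \<mu> (U \<inter> X) = 0"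
    using empty by (auto simp: measure_support_def sp not_gr_zero)
  then obtain U where U: "\<And>x. x \<in> X \<Longrightarrow> open (U x) \<and> x \<in> U x \<and> emeasure \<mu> (U x \<inter> X) = 0"
    by metis
  obtain D where D: "D \<subseteq> X" "finite D" "X \<subseteq> (\<Union>x\<in>D. U x)"
    using compactE_image[OF \<open>compact X\<close>, of X U] U by blast
  have "U x \<inter> X \<in> null_sets \<mu>" if "x \<in> D" for x
    using D(1) U that open_Int_in_sets[OF sets] by (intro null_setsI) blast+
  hence "(\<Union>x\<in>D. U x \<inter> X) \<in> null_sets \<mu>"
    using D(2) by (intro null_sets_UN') (simp_all add: countable_finite)
  moreover have "(\<Union>x\<in>D. U x \<inter> X) = X"
    using D by blast
  ultimately show False
    using \<open>emeasure \<mu> X \<noteq> 0\<close> by auto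
qed

lemma infinite_Sep_of_weakly_mixing:
  assumes X: "compact X" and "prob_space \<mu>" and sets: "sets \<mu> = sets (restrict_space borel X)"
    and f: "f \<in> measurable \<mu> \<mu>" and mix: "weakly_mixing \<mu> f"
    and supp: "\<not> (\<exists>x. measure_support \<mu> = {x})"
  shows "infinite_separation_numbers X f"
proof
  assume fin: "finite_separation_numbers X f"
  interpret prob_space \<mu> by fact
  have sp: "space \<mu> = X"
    using sets_eq_imp_space_eq[OF sets] by (simp add: space_restrict_space)
  have id: "(\<lambda>x. x) \<in> borel_measurable \<mu>"
    unfolding measurable_cong_sets[OF sets refl] by (intro measurable_restrict_space1) simp
  have fk: "f ^^ k \<in> measurable \<mu> \<mu>" for k
    by (rule measurable_compose_n[OF f])
  have fk_borel: "f ^^ k \<in> borel_measurable \<mu>" for k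
    using measurable_compose[OF fk id] by simp
  have "measure_support \<mu> \<noteq> {}"
    using X sets emeasure_space_1 by (intro measure_support_nonempty) (auto simp: sp)
  then obtain p q where pq: "p \<in> measure_support \<mu>" "q \<in> measure_support \<mu>" "p \<noteq> q"
    using supp by blast
  \<comment> \<open>Any point is at distance at least \<open>2 * \<delta>\<close> from
    \<open>p\<close> or \<open>q\<close>, hence at least \<open>\<delta>\<close> from every point of
    the corresponding ball.\<close>
  define \<delta> where "\<delta> = dist p q / 4"
  have \<delta>: "\<delta> > 0" using pq by (simp add: \<delta>_def)
  define A B where "A = ball p \<delta> \<inter> X" and "B = ball q \<delta> \<inter> X"
  have AB: "A \<in> sets \<mu>" "B \<in> sets \<mu>"
    by (auto simp: A_def B_def intro: open_Int_in_sets[OF sets])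
  have "emeasure \<mu> A > 0" "emeasure \<mu> B > 0"
    using pq \<delta> by (auto simp: measure_support_def sp A_def B_def)
  hence ABpos: "measure \<mu> A > 0" "measure \<mu> B > 0"
    by (auto simp: emeasure_eq_measure)
  define m where "m = min (measure \<mu> A) (measure \<mu> B)"
  have m: "0 < m" "m \<le> 1"
    using ABpos by (auto simp: m_def min_le_iff_disj)
  \<comment> \<open>Half of \<open>m\<close> leaves a gap to the average frequency \<open>m\<close>
    that mixing will force.\<close>
  have "Sep X f \<delta> (m / 2) < \<infinity>"
    using fin m \<delta> by (auto simp: finite_separation_numbers_def)
  then obtain F where F: "finite F" "F \<subseteq> X"
    and shadow: "\<And>y. y \<in> X \<Longrightarrow> \<exists>x\<in>F. \<exists>N. \<forall>n\<ge>N. real (sep_count f \<delta> y x n) < m / 2 * real n"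
    using finite_shadowing_set[of X f \<delta> "m / 2"] m \<delta> by (metis half_gt_zero)

  define E where "E = (\<lambda>x k. {y \<in> space \<mu>. dist ((f ^^ k) y) ((f ^^ k) x) \<ge> \<delta>})"
  have E: "E x k \<in> sets \<mu>" for x k
  proof -
    have "(\<lambda>z. dist z ((f ^^ k) x)) \<in> borel_measurable borel"
      by (intro borel_measurable_continuous_onI continuous_intros)
    hence [measurable]: "(\<lambda>y. dist ((f ^^ k) y) ((f ^^ k) x)) \<in> borel_measurable \<mu>"
      by (rule measurable_compose[OF fk_borel])
    show ?thesis unfolding E_def by measurable
  qed
  have count: "real (sep_count f \<delta> y x n) = (\<Sum>k<n. indicator (E x k) y)" if "y \<in> X" for x y n
  proof -
    have "(\<Sum>k<n. indicator (E x k) y :: real) = real (card {k\<in>{..<n}. y \<in> E x k})"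
      by (simp add: indicator_def sum.If_cases Int_def)
    also have "{k\<in>{..<n}. y \<in> E x k} = {k. k < n \<and> dist ((f ^^ k) y) ((f ^^ k) x) \<ge> \<delta>}"
      using that by (auto simp: E_def sp)
    finally show ?thesis
      by (simp add: sep_count_def)
  qed

  \<comment> \<open>On \<open>Y (x, N)\<close> the shadowing point and the starting time are the
    same for all points. Countably many such sets cover \<open>X\<close>, so one has positive
    measure.\<close>
  define Y where "Y = (\<lambda>(x, N). {y \<in> space \<mu>. \<forall>n\<ge>N. (\<Sum>k<n. indicator (E x k) y) < m / 2 * real n})"
  have Y: "Y i \<in> sets \<mu>" for i
  proof -
    obtain x N where i: "i = (x, N)" by (cases i)
    have [measurable]: "E x k \<in> sets \<mu>" for k by (rule E)
    show ?thesis unfolding Y_def i prod.case by measurable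
  qed
  have "X \<subseteq> (\<Union>i\<in>F \<times> UNIV. Y i)"
  proof
    fix y assume y: "y \<in> X"
    then obtain x N where "x \<in> F" "\<forall>n\<ge>N. real (sep_count f \<delta> y x n) < m / 2 * real n"
      using shadow by blast
    thus "y \<in> (\<Union>i\<in>F \<times> UNIV. Y i)"
      using y count by (intro UN_I[of "(x, N)"]) (auto simp: Y_def sp)
  qed
  hence "(\<Union>i\<in>F \<times> UNIV. Y i) = space \<mu>"
    using sets.sets_into_space[OF Y] by (auto simp: sp)
  hence "(\<Union>i\<in>F \<times> UNIV. Y i) \<notin> null_sets \<mu>"
    using emeasure_space_1 by auto
  moreover have "countable (F \<times> (UNIV :: nat set))"
    using F by (intro countable_SIGMA) (auto simp: countable_finite)
  ultimately obtain i where "Y i \<notin> null_sets \<mu>"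
    using null_sets_UN' by blast
  then obtain x N where "Y (x, N) \<notin> null_sets \<mu>"
    by (cases i) auto
  hence Ypos: "measure \<mu> (Y (x, N)) > 0"
    using Y[of "(x, N)"] by (auto simp: null_sets_def emeasure_eq_measure zero_less_measure_iff)
  let ?Y = "Y (x, N)"

  have upper: "(\<Sum>k<n. measure \<mu> (?Y \<inter> E x k)) \<le> m / 2 * real n * measure \<mu> ?Y" if "n \<ge> N" for n
  proof -
    have "(\<Sum>k<n. measure \<mu> (?Y \<inter> E x k)) = (\<integral>y. (\<Sum>k<n. indicator (?Y \<inter> E x k) y) \<partial>\<mu>)"
      using Y E by (subst Bochner_Integration.integral_sum)
        (auto simp: emeasure_eq_measure sets.Int intro!: sum.cong
          arg_cong[of _ _ "measure \<mu>"] dest: sets.sets_into_space)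
    also have "\<dots> \<le> (\<integral>y. m / 2 * real n * indicator ?Y y \<partial>\<mu>)"
    proof (rule integral_mono)
      show "integrable \<mu> (\<lambda>y. \<Sum>k<n. indicator (?Y \<inter> E x k) y :: real)"
        using Y E by (intro Bochner_Integration.integrable_sum integrable_real_indicator)
          (auto simp: emeasure_eq_measure)
      show "integrable \<mu> (\<lambda>y. m / 2 * real n * indicator ?Y y)"
        using Y by (intro integrable_mult_right integrable_real_indicator)
          (auto simp: emeasure_eq_measure)
      fix y
      have "(\<Sum>k<n. indicator (?Y \<inter> E x k) y) = indicator ?Y y * (\<Sum>k<n. indicator (E x k) y :: real)"
        by (simp add: indicator_inter_arith sum_distrib_left)
      also have "\<dots> \<le> m / 2 * real n * indicator ?Y y"
        using that by (auto simp: Y_def indicator_def split: if_splits intro: less_imp_le)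
      finally show "(\<Sum>k<n. indicator (?Y \<inter> E x k) y) \<le> m / 2 * real n * indicator ?Y y" .
    qed
    also have "\<dots> = m / 2 * real n * measure \<mu> ?Y"
      using Y sets.sets_into_space[OF Y[of "(x, N)"]] by (simp add: Int_absorb2)
    finally show ?thesis .
  qed

  \<comment> \<open>The failure of independence between \<open>?Y\<close> and the preimage of
    \<open>S\<close> at time \<open>k\<close>; weak mixing makes its averages tend to 0.\<close>
  define e where "e = (\<lambda>S k. \<bar>measure \<mu> (((f ^^ k) -` S \<inter> space \<mu>) \<inter> ?Y) - measure \<mu> S * measure \<mu> ?Y\<bar>)"
  have lower: "m * measure \<mu> ?Y - e A k - e B k \<le> measure \<mu> (?Y \<inter> E x k)" for k
  proof -
    have *: "m * measure \<mu> ?Y - e S k \<le> measure \<mu> (?Y \<inter> E x k)"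
      if S: "(f ^^ k) -` S \<inter> space \<mu> \<subseteq> E x k" "m \<le> measure \<mu> S" for S
    proof -
      have "measure \<mu> (((f ^^ k) -` S \<inter> space \<mu>) \<inter> ?Y) \<le> measure \<mu> (?Y \<inter> E x k)"
        using S Y E by (intro finite_measure_mono) auto
      moreover have "m * measure \<mu> ?Y \<le> measure \<mu> S * measure \<mu> ?Y"
        using S by (intro mult_right_mono) auto
      ultimately show ?thesis
        unfolding e_def by linarith
    qed
    let ?z = "(f ^^ k) x"
    \<comment> \<open>Which of the two balls is far from the orbit of \<open>x\<close> varies with
      \<open>k\<close>, so both errors are subtracted to get one bound for all
      \<open>k\<close>.\<close>
    have "2 * \<delta> \<le> dist p ?z \<or> 2 * \<delta> \<le> dist q ?z"
      unfolding \<delta>_def by metric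
    moreover have "e A k \<ge> 0" "e B k \<ge> 0"
      by (auto simp: e_def)
    moreover have "(f ^^ k) -` A \<inter> space \<mu> \<subseteq> E x k" if "2 * \<delta> \<le> dist p ?z"
    proof
      fix y assume "y \<in> (f ^^ k) -` A \<inter> space \<mu>"
      moreover have "dist p ?z \<le> dist p ((f ^^ k) y) + dist ((f ^^ k) y) ?z"
        by (rule dist_triangle)
      ultimately show "y \<in> E x k"
        using that by (simp add: E_def A_def)
    qed
    moreover have "(f ^^ k) -` B \<inter> space \<mu> \<subseteq> E x k" if "2 * \<delta> \<le> dist q ?z"
    proof
      fix y assume "y \<in> (f ^^ k) -` B \<inter> space \<mu>"
      moreover have "dist q ?z \<le> dist q ((f ^^ k) y) + dist ((f ^^ k) y) ?z"
        by (rule dist_triangle)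
      ultimately show "y \<in> E x k"
        using that by (simp add: E_def B_def)
    qed
    ultimately show ?thesis
      using *[of A] *[of B] by (fastforce simp: m_def)
  qed

  let ?avg = "\<lambda>S n. (\<Sum>k<n. e S k) / real n"
  have avg: "?avg S \<longlonglongrightarrow> 0" if "S \<in> sets \<mu>" for S
    using mix that Y[of "(x, N)"] unfolding weakly_mixing_def e_def by blast
  have ineq: "m * measure \<mu> ?Y - ?avg A n - ?avg B n \<le> m / 2 * measure \<mu> ?Y" if "n \<ge> max 1 N" for n
  proof -
    have "real n * (m * measure \<mu> ?Y) - (\<Sum>k<n. e A k) - (\<Sum>k<n. e B k)
          = (\<Sum>k<n. m * measure \<mu> ?Y - e A k - e B k)"
      by (simp add: sum_subtractf)
    also have "\<dots> \<le> (\<Sum>k<n. measure \<mu> (?Y \<inter> E x k))"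
      by (intro sum_mono lower)
    also have "\<dots> \<le> m / 2 * real n * measure \<mu> ?Y"
      using upper that by simp
    finally have "(real n * (m * measure \<mu> ?Y) - (\<Sum>k<n. e A k) - (\<Sum>k<n. e B k)) / real n
                  \<le> (m / 2 * real n * measure \<mu> ?Y) / real n"
      by (rule divide_right_mono) simp
    thus ?thesis
      using that by (simp add: diff_divide_distrib)
  qed
  have "(\<lambda>n. m * measure \<mu> ?Y - ?avg A n - ?avg B n) \<longlonglongrightarrow> m * measure \<mu> ?Y - 0 - 0"
    by (intro tendsto_diff tendsto_const avg AB)
  hence "m * measure \<mu> ?Y - 0 - 0 \<le> m / 2 * measure \<mu> ?Y"
    by (rule LIMSEQ_le_const2) (use ineq in blast)
  thus False
    using m Ypos by simp
qed

theorem theorem1p1: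
  fixes X :: "'a::metric_space set" and f :: "'a \<Rightarrow> 'a"
  assumes "compact X"
    and "continuous_on X f"
    and "f ` X \<subseteq> X"
    and "top_entropy X f > 0 \<or>
         (\<exists>\<mu>. prob_space \<mu> \<and> sets \<mu> = sets (restrict_space borel X) \<and>
              invariant_measure \<mu> f \<and> weakly_mixing \<mu> f \<and>
              \<not> (\<exists>x. measure_support \<mu> = {x}))"
  shows "infinite_separation_numbers X f"
  using assms(4)
proof (elim disjE exE conjE)
  assume "top_entropy X f > 0"
  thus ?thesis
    using top_entropy_le_0_of_finite_Sep[OF assms(1-3)] by (meson not_le)
next
  fix \<mu> :: "'a measure"
  assume "prob_space \<mu>" "sets \<mu> = sets (restrict_space borel X)" "invariant_measure \<mu> f"
    "weakly_mixing \<mu> f" "\<not> (\<exists>x. measure_support \<mu> = {x})"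
  thus ?thesis
    by (intro infinite_Sep_of_weakly_mixing[OF assms(1)]) (auto simp: invariant_measure_def)
qed

end
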